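(* Let $\mathcal{P}\subset\mathbb{Z}$ be the set of prime numbers. For every $0<\alpha<1$, $\mathcal{P}$ is $S_\alpha$-massive, where $S_\alpha$ is the $\alpha$-stable random walk on $\mathbb{Z}$.
   Context: Let $S$ be the symmetric simple random walk on $\mathbb{Z}$, with transition operator $P$. For $0<\alpha<1$, the $\alpha$-stable random walk $S_\alpha$ is the (transient) random walk on $\mathbb{Z}$ with transition operator $P_\alpha=I-(I-P)^{\alpha/2}=\sum_{k\geq1}c_kP^k$, where $c_k=(-1)^{k+1}\binom{\alpha/2}{k}\geq0$. A set $B\subset\mathbb{Z}$ is called $S_\alpha$-massive if for every starting point $x\in\mathbb{Z}$ the walk $S_\alpha$ started at $x$ hits $B$ with probability $1$. *)

theory Defs
  imports "HOL-Probability.Probability" "HOL-Computational_Algebra.Primes"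
begin

text \<open>k-step transition probability P^k(x, x+d) of the symmetric simple random walk on Z.\<close>
fun srw_power :: "nat \<Rightarrow> int \<Rightarrow> real" where
  "srw_power 0 d = (if d = 0 then 1 else 0)"
| "srw_power (Suc k) d = (srw_power k (d - 1) + srw_power k (d + 1)) / 2"

definition stable_coeff :: "real \<Rightarrow> nat \<Rightarrow> real" where
  "stable_coeff \<alpha> k = (-1) ^ (k + 1) * ((\<alpha> / 2) gchoose k)"

definition stable_kernel :: "real \<Rightarrow> int \<Rightarrow> real" where
  "stable_kernel \<alpha> d = (\<Sum>k. stable_coeff \<alpha> (Suc k) * srw_power (Suc k) d)"

definition stable_step :: "real \<Rightarrow> int measure" where
  "stable_step \<alpha> = density (count_space UNIV) (\<lambda>d. ennreal (stable_kernel \<alpha> d))"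

text \<open>Path space of i.i.d. increments; the walk from x is S_n = x + sum_{i<n} \<omega> i.\<close>
definition stable_increments :: "real \<Rightarrow> (nat \<Rightarrow> int) measure" where
  "stable_increments \<alpha> = PiM UNIV (\<lambda>_. stable_step \<alpha>)"

definition stable_massive :: "real \<Rightarrow> int set \<Rightarrow> bool" where
  "stable_massive \<alpha> B \<longleftrightarrow>
     (\<forall>x::int. measure (stable_increments \<alpha>)
        {\<omega> \<in> space (stable_increments \<alpha>). \<exists>n. x + (\<Sum>i<n. \<omega> i) \<in> B} = 1)"

end

theory Submission
  imports Defs "HOL-Computational_Algebra.Squarefree" "HOL-Real_Asymp.Real_Asymp"
begin

text \<open>
  With \<open>s = \<alpha>/2\<close> and \<open>p\<^sub>k\<close> the law of the simple random walk after \<open>k\<close> steps, the Green function of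
  the stable walk is \<open>g(x) = \<Sum>\<^sub>k (s)\<^sub>k/k! p\<^sub>k(x)\<close>, because \<open>(1 - t)\<^sup>s (1 - t)\<^bsup>-s\<^esup> = 1\<close>. It satisfies
  \<open>(x - s) g(x) = (x - 1 + s) g(x - 1)\<close>, so that \<open>g(x)\<close> is of order \<open>\<bar>x\<bar>\<^bsup>\<alpha>-1\<^esup>\<close>.

  Let \<open>A\<close> be a finite set of primes beyond \<open>\<bar>x\<bar>\<close> and \<open>S = \<Sum>\<^sub>A 1/p \<ge> 1\<close>. The potential
  \<open>F(y) = \<Sum>\<^sub>A p\<^bsup>-\<alpha>\<^esup> g(y - p)\<close> is at most a constant times \<open>S\<close> everywhere and at least a constant times \<open>S\<close>
  at \<open>x\<close>. By the maximum principle, \<open>F/sup F\<close> is a lower bound for the hitting probability of the primes,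
  which is therefore bounded away from \<open>0\<close> uniformly in \<open>x\<close>; such an \<open>A\<close> exists because \<open>\<Sum> 1/p\<close> diverges.
  The escape probability \<open>h\<close> is a bounded solution of a homogeneous linear equation (harmonic off the
  primes, zero on them), and every solution with values in \<open>[0, 1]\<close> is at most some \<open>q < 1\<close>. Rescaling
  gives \<open>h \<le> q\<^sup>n\<close> for all \<open>n\<close>.
\<close>

subsection \<open>The simple random walk\<close>

lemma srw_power_nonneg: "0 \<le> srw_power k d"
  by (induction k arbitrary: d) auto

lemma srw_power_minus: "srw_power k (- d) = srw_power k d"
proof (induction k arbitrary: d)
  case (Suc k)
  have "- d - 1 = - (d + 1)" "- d + 1 = - (d - 1)" by auto
  then show ?case by (simp only: srw_power.simps Suc.IH add.commute)
qed auto

text \<open>The quotient of neighbouring binomials hidden in \<open>srw_power\<close>. With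
  denominators cleared it also holds off the support and for the wrong parity.\<close>

lemma srw_power_shift_two:
  "(of_nat k + 1 + of_int x) * srw_power k (x + 1) = (of_nat k + 1 - of_int x) * srw_power k (x - 1)"
proof (induction k arbitrary: x)
  case 0
  then show ?case by (auto simp: add_eq_0_iff)
next
  case (Suc k)
  have l: "(of_nat k + 1 + of_int y) * srw_power (Suc k) y = (of_nat k + 1) * srw_power k (y - 1)" for y
    using Suc.IH[of y] by (simp add: field_simps)
  have r: "(of_nat k + 1 - of_int y) * srw_power (Suc k) y = (of_nat k + 1) * srw_power k (y + 1)" for y
    using Suc.IH[of y] by (simp add: field_simps)
  \<comment> \<open>Both sides equal \<open>(of_nat k + 1) * srw_power k x\<close>.\<close>
  show ?case
    using l[of "x + 1"] r[of "x - 1"] by (simp add: algebra_simps)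
qed

text \<open>Binomial absorption, \<open>j * (n choose j) = n * (n - 1 choose (j - 1))\<close>.
  Together with its mirror image it yields the recursion for the Green function.\<close>

lemma srw_power_Suc_left:
  "(of_nat (Suc k) + of_int x) * srw_power (Suc k) x = of_nat (Suc k) * srw_power k (x - 1)"
  using srw_power_shift_two[of k x] by (simp add: field_simps)

lemma srw_power_Suc_right:
  "(of_nat (Suc k) - of_int x) * srw_power (Suc k) x = of_nat (Suc k) * srw_power k (x + 1)"
  using srw_power_shift_two[of k x] by (simp add: field_simps)

text \<open>The two bounds feed each other: the value at 0 after \<open>Suc k\<close> steps is the
  value at 1 after \<open>k\<close> steps, and the value at 1 is \<open>(k + 1) / (k + 2)\<close>
  times the previous value at 0. With the offsets 1 and 2 the induction closes by
  \<open>(k + 1) * (k + 3) \<le> (k + 2)^2\<close>.\<close>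

lemma srw_power_0_1_le:
  "srw_power k 0 \<le> 1 / sqrt (real k + 1) \<and> srw_power k 1 \<le> 1 / sqrt (real k + 2)"
proof (induction k)
  case (Suc k)
  have z: "srw_power (Suc k) 0 = srw_power k 1"
    using srw_power_minus[of k 1] by simp
  have "srw_power (Suc k) 1 = (real k + 1) / (real k + 2) * srw_power k 0"
    using srw_power_Suc_left[of k 1] by (simp add: field_simps del: srw_power.simps)
  also have "\<dots> \<le> (real k + 1) / (real k + 2) * (1 / sqrt (real k + 1))"
    using Suc.IH by (intro mult_left_mono) auto
  also have "\<dots> = sqrt (real k + 1) / (real k + 2)"
    by (metis add_nonneg_nonneg divide_divide_eq_left mult.commute of_nat_0_le_iff real_div_sqrt times_divide_eq_left mult_1 zero_le_one)
  also have "\<dots> \<le> 1 / sqrt (real k + 3)"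
  proof -
    have "sqrt (real k + 1) * sqrt (real k + 3) = sqrt ((real k + 1) * (real k + 3))"
      by (simp add: real_sqrt_mult)
    also have "\<dots> \<le> sqrt ((real k + 2)\<^sup>2)"
      by (rule real_sqrt_le_mono) (simp add: power2_eq_square algebra_simps)
    finally show ?thesis by (simp add: field_simps)
  qed
  finally show ?case using z Suc.IH by (simp add: algebra_simps)
qed simp

text \<open>By the quotient identity the law does not increase away from the origin along each
  parity class, so the values at 0 and 1 dominate.\<close>

lemma srw_power_le: "srw_power k x \<le> 1 / sqrt (real k + 1)"
proof -
  have nat: "srw_power k (int n) \<le> 1 / sqrt (real k + 1)" for n
  proof (induction n rule: less_induct)
    case (less n)
    consider "n = 0" | "n = 1" | m where "n = m + 2"
      by (metis One_nat_def Suc_1 add.commute add_Suc_right add_0_right not0_implies_Suc)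
    then show ?case
    proof cases
      case 1 then show ?thesis using srw_power_0_1_le[of k] by simp
    next
      case 2
      have "1 / sqrt (real k + 2) \<le> 1 / sqrt (real k + 1)"
        by (intro divide_left_mono) auto
      then show ?thesis using srw_power_0_1_le[of k] 2 by simp
    next
      case (3 m)
      have e: "(real k + 2 + real m) * srw_power k (int n) = (real k - real m) * srw_power k (int m)"
        using srw_power_shift_two[of k "int m + 1"] 3 by (simp add: algebra_simps)
      have "\<dots> \<le> (real k + 2 + real m) * srw_power k (int m)"
        by (intro mult_right_mono srw_power_nonneg) auto
      then have "(real k + 2 + real m) * srw_power k (int n) \<le> (real k + 2 + real m) * srw_power k (int m)"
        using e by simp
      then have "srw_power k (int n) \<le> srw_power k (int m)"
        by (subst (asm) mult_le_cancel_left_pos) auto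
      then show ?thesis using less[of m] 3 by simp
    qed
  qed
  show ?thesis
    using nat[of "nat \<bar>x\<bar>"] srw_power_minus[of k x] by (cases "x \<ge> 0") auto
qed

subsection \<open>Power inequalities\<close>

text \<open>Bernoulli's inequality, as the weighted AM-GM inequality for \<open>1 + u\<close> and
  1.\<close>

lemma powr_one_plus_le:
  fixes u b :: real
  assumes "0 \<le> b" "b \<le> 1" "-1 < u"
  shows "(1 + u) powr b \<le> 1 + b * u"
  using Youngs_inequality_0[of b "1 - b" "1 + u" 1] assms by (simp add: algebra_simps)

lemma one_minus_ge_powr:
  fixes b y :: real
  assumes "0 \<le> b" "b \<le> 1" "1 < y"
  shows "((y - 1) / y) powr b \<le> 1 - b / y"
  using powr_one_plus_le[of b "-1/y"] assms by (simp add: field_simps)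

text \<open>Bernoulli at \<open>1/z\<close> with \<open>z = y - b\<close>, then inverted. Like
  \<open>one_minus_ge_powr\<close>, it bounds \<open>1 - b / y\<close> by a power of some
  \<open>w / (w + 1)\<close>, so that products over unit steps of \<open>y\<close>
  telescope.\<close>

lemma one_minus_le_powr:
  fixes b y :: real
  assumes "0 \<le> b" "b \<le> 1" "b < y"
  shows "1 - b / y \<le> ((y - b) / (y - b + 1)) powr b"
proof -
  define z where "z = y - b"
  have z: "z > 0" "y = z + b" using assms by (auto simp: z_def)
  have "((z + 1) / z) powr b \<le> 1 + b / z"
    using powr_one_plus_le[of b "1/z"] assms z by (simp add: field_simps)
  moreover have "((z + 1) / z) powr b = inverse ((z / (z + 1)) powr b)"
    using z by (simp add: powr_divide)
  ultimately have "inverse (1 + b / z) \<le> (z / (z + 1)) powr b"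
    using z by (metis inverse_inverse_eq le_imp_inverse_le powr_gt_zero divide_pos_pos inverse_positive_iff_positive add_pos_pos zero_less_one less_irrefl)
  moreover have "inverse (1 + b / z) = 1 - b / y"
    using z assms by (simp add: field_simps)
  ultimately show ?thesis by (simp add: z_def)
qed

text \<open>Discrete integration: each term is at most \<open>1 / a\<close> times the matching
  increment of \<open>x powr a\<close>, by Bernoulli.\<close>

lemma sum_powr_le:
  fixes a :: real
  assumes "0 < a" "a \<le> 1"
  shows "(\<Sum>j=1..n. real j powr (a - 1)) \<le> real n powr a / a"
proof (induction n)
  case (Suc n)
  have "real n powr a + a * real (Suc n) powr (a - 1) \<le> real (Suc n) powr a"
  proof (cases "n = 0")
    case False
    have "(real n / real (Suc n)) powr a \<le> 1 - a / real (Suc n)"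
      using one_minus_ge_powr[of a "real (Suc n)"] assms False by simp
    then have "real (Suc n) powr a * (real n / real (Suc n)) powr a 
        \<le> real (Suc n) powr a * (1 - a / real (Suc n))"
      by (intro mult_left_mono) auto
    moreover have "real (Suc n) powr a * (real n / real (Suc n)) powr a = real n powr a"
      by (simp add: powr_divide)
    moreover have "real (Suc n) powr (a - 1) = real (Suc n) powr a / real (Suc n)"
      by (simp add: powr_diff)
    ultimately show ?thesis by (simp add: algebra_simps)
  qed (use assms in auto)
  then show ?case using Suc assms by (simp add: field_simps)
qed auto

subsection \<open>The Green function\<close>

text \<open>The coefficient of \<open>z^k\<close> in \<open>(1 - z)^(-t)\<close>. The value
  \<open>t = s\<close> serves the Green function; \<open>t = - s\<close> gives the step coefficients
  up to sign.\<close>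

definition rising_coeff :: "real \<Rightarrow> nat \<Rightarrow> real" where
  "rising_coeff t k = pochhammer t k / fact k"

lemma rising_coeff_0 [simp]: "rising_coeff t 0 = 1"
  by (simp add: rising_coeff_def)

lemma rising_coeff_Suc: "real (Suc k) * rising_coeff t (Suc k) = (real k + t) * rising_coeff t k"
  unfolding rising_coeff_def pochhammer_Suc fact_Suc
  by (simp add: add.commute mult.commute del: of_nat_Suc)

lemma rising_coeff_nonneg: "0 < t \<Longrightarrow> 0 \<le> rising_coeff t k"
  by (simp add: rising_coeff_def pochhammer_nonneg)

text \<open>Consecutive quotients are \<open>1 - (1 - t) / (k + 1)\<close>, and their bounds from
  \<open>one_minus_le_powr\<close> telescope.\<close>

lemma rising_coeff_le:
  assumes "0 < t" "t < 1"
  shows "rising_coeff t k \<le> (t / (real k + t)) powr (1 - t)"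
proof (induction k)
  case (Suc k)
  have "rising_coeff t (Suc k) = (1 - (1 - t) / real (Suc k)) * rising_coeff t k"
    using rising_coeff_Suc[of k t] by (simp add: field_simps)
  also have "\<dots> \<le> ((real k + t) / (real (Suc k) + t)) powr (1 - t) * (t / (real k + t)) powr (1 - t)"
    using one_minus_le_powr[of "1 - t" "real (Suc k)"] assms Suc.IH rising_coeff_nonneg[of t k]
    by (intro mult_mono) (auto simp: algebra_simps)
  also have "\<dots> = (t / (real (Suc k) + t)) powr (1 - t)"
    using assms by (simp flip: powr_mult)
  finally show ?case .
qed (use assms in auto)

text \<open>Partial sums correspond to multiplying the generating function by
  \<open>1 / (1 - z)\<close>.\<close>

lemma sum_rising_coeff: "(\<Sum>k\<le>n. rising_coeff t k) = rising_coeff (t + 1) n"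
proof (induction n)
  case (Suc n)
  have "real (Suc n) * rising_coeff t (Suc n) = t * rising_coeff (t + 1) n"
    unfolding rising_coeff_def pochhammer_rec fact_Suc by (simp del: of_nat_Suc)
  then have "real (Suc n) * (rising_coeff (t + 1) n + rising_coeff t (Suc n)) 
      = real (Suc n) * rising_coeff (t + 1) (Suc n)"
    unfolding distrib_left rising_coeff_Suc[of n "t + 1"] by (simp add: algebra_simps)
  then show ?case using Suc by (subst (asm) mult_cancel_left) auto
qed simp

text \<open>The identity \<open>(1 - z)^s * (1 - z)^(-s) = 1\<close>, obtained from the Vandermonde
  formula for rising factorials.\<close>

lemma rising_coeff_convolution:
  "(\<Sum>j\<le>n. rising_coeff (- s) j * rising_coeff s (n - j)) = (if n = 0 then 1 else 0)"
proof -
  have "(\<Sum>j\<le>n. rising_coeff (- s) j * rising_coeff s (n - j)) 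
      = (\<Sum>j\<le>n. of_nat (n choose j) * pochhammer (- s) j * pochhammer s (n - j)) / fact n"
    unfolding sum_divide_distrib
    by (intro sum.cong) (auto simp: rising_coeff_def binomial_fact)
  also have "\<dots> = pochhammer (- s + s) n / fact n"
    by (simp only: pochhammer_binomial_sum)
  finally show ?thesis by (simp add: pochhammer_0_left)
qed

section \<open>Coefficients of the stable step law\<close>

lemma stable_coeff_eq: "stable_coeff \<alpha> k = - rising_coeff (- \<alpha> / 2) k"
proof -
  have "(-1::real) ^ k * (-1) ^ k = 1" by (simp flip: power_mult_distrib)
  then show ?thesis
    by (simp add: stable_coeff_def rising_coeff_def gbinomial_pochhammer flip: mult.assoc)
qed

lemma stable_coeff_Suc_nonneg:
  assumes "0 < \<alpha>" "\<alpha> < 2"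
  shows "0 \<le> stable_coeff \<alpha> (Suc k)"
proof -
  have "pochhammer (- \<alpha> / 2) (Suc k) = (- \<alpha> / 2) * pochhammer (1 - \<alpha> / 2) k"
    by (simp add: pochhammer_rec)
  moreover have "0 \<le> pochhammer (1 - \<alpha> / 2) k"
    using assms by (intro pochhammer_nonneg) auto
  ultimately show ?thesis using assms
    by (simp add: stable_coeff_eq rising_coeff_def del: pochhammer_Suc)
qed

text \<open>By \<open>sum_rising_coeff\<close> the partial sums are 1 minus a coefficient of
  \<open>(1 - z)^(s - 1)\<close>, and these coefficients tend to 0.\<close>

lemma sums_stable_coeff:
  assumes "0 < \<alpha>" "\<alpha> < 2"
  shows "(\<lambda>k. stable_coeff \<alpha> (Suc k)) sums 1"
proof -
  define s where "s = \<alpha> / 2"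
  have s: "0 < s" "s < 1" using assms by (auto simp: s_def)
  have *: "(\<Sum>k\<le>n. stable_coeff \<alpha> (Suc k)) = 1 - rising_coeff (1 - s) (Suc n)" for n
    using sum_rising_coeff[of "- s" "Suc n"]
    by (simp add: sum.atMost_Suc_shift stable_coeff_eq s_def sum_negf algebra_simps del: sum.atMost_Suc)
  have "(\<lambda>n. ((1 - s) / (real n + (1 - s))) powr s) \<longlonglongrightarrow> 0"
    using s by real_asymp
  moreover have "norm (rising_coeff (1 - s) n) \<le> ((1 - s) / (real n + (1 - s))) powr s" for n
    using s rising_coeff_le[of "1 - s" n] rising_coeff_nonneg[of "1 - s" n] by simp
  ultimately have "(\<lambda>n. rising_coeff (1 - s) n) \<longlonglongrightarrow> 0"
    by (intro Lim_null_comparison[where f = "rising_coeff (1 - s)"] always_eventually allI)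
  then have "(\<lambda>n. rising_coeff (1 - s) (Suc n)) \<longlonglongrightarrow> 0"
    by (rule LIMSEQ_Suc)
  then have "(\<lambda>n. 1 - rising_coeff (1 - s) (Suc n)) \<longlonglongrightarrow> 1 - 0"
    by (intro tendsto_intros)
  then show ?thesis unfolding sums_def_le * by simp
qed

section \<open>The Green function: convergence, recursion and decay\<close>

definition green :: "real \<Rightarrow> int \<Rightarrow> real" where
  "green s x = (\<Sum>k. rising_coeff s k * srw_power k x)"

text \<open>The coefficient contributes the exponent \<open>s - 1\<close> and the walk contributes
  \<open>- 1 / 2\<close>. The total is below -1 precisely for \<open>s < 1 / 2\<close>, that is
  \<alpha> < 1: this is where transience enters.\<close>

lemma rising_coeff_srw_power_le:
  assumes "0 < s" "s < 1"
  shows "rising_coeff s k * srw_power k x \<le> (real k + s) powr (s - 3 / 2)"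
proof -
  have "rising_coeff s k \<le> (real k + s) powr (s - 1)"
  proof -
    have "rising_coeff s k \<le> (s / (real k + s)) powr (1 - s)"
      using assms by (rule rising_coeff_le)
    also have "\<dots> \<le> (1 / (real k + s)) powr (1 - s)"
      using assms by (intro powr_mono2 divide_right_mono) auto
    also have "\<dots> = (real k + s) powr (s - 1)"
      using assms by (simp add: powr_divide powr_minus_divide[symmetric])
    finally show ?thesis .
  qed
  moreover have "srw_power k x \<le> (real k + s) powr (- 1 / 2)"
  proof -
    have "srw_power k x \<le> 1 / sqrt (real k + 1)"
      by (rule srw_power_le)
    also have "\<dots> \<le> 1 / sqrt (real k + s)"
      using assms by (intro divide_left_mono) auto
    also have "\<dots> = (real k + s) powr (- 1 / 2)"
      using assms by (simp add: powr_half_sqrt powr_minus_divide)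
    finally show ?thesis .
  qed
  ultimately have "rising_coeff s k * srw_power k x \<le> (real k + s) powr (s - 1) * (real k + s) powr (- 1 / 2)"
    by (intro mult_mono srw_power_nonneg) auto
  then show ?thesis by (simp add: flip: powr_add)
qed

context
  fixes s :: real
  assumes s: "0 < s" "s < 1 / 2"
begin

lemma green_term_nonneg: "0 \<le> rising_coeff s k * srw_power k x"
  using rising_coeff_nonneg s srw_power_nonneg by simp

lemma summable_green: "summable (\<lambda>k. rising_coeff s k * srw_power k x)"
proof (rule summable_comparison_test_ev)
  show "\<forall>\<^sub>F k in sequentially. norm (rising_coeff s k * srw_power k x) \<le> real k powr (s - 3 / 2)"
  proof (rule eventually_sequentiallyI[of 1])
    fix k :: nat assume "1 \<le> k"
    have "rising_coeff s k * srw_power k x \<le> (real k + s) powr (s - 3 / 2)"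
      using s by (intro rising_coeff_srw_power_le) auto
    also have "\<dots> \<le> real k powr (s - 3 / 2)"
      using s \<open>1 \<le> k\<close> by (intro powr_mono2') auto
    finally show "norm (rising_coeff s k * srw_power k x) \<le> real k powr (s - 3 / 2)"
      using green_term_nonneg by simp
  qed
  show "summable (\<lambda>k. real k powr (s - 3 / 2))"
    using s by (simp add: summable_real_powr_iff)
qed

lemma green_minus: "green s (- x) = green s x"
  by (simp add: green_def srw_power_minus)

lemma green_0_ge: "1 \<le> green s 0"
  using sum_le_suminf[OF summable_green[of 0], of "{0}"] green_term_nonneg by (simp add: green_def)

text \<open>
  The sums \<open>A\<close> diverge as \<open>n \<rightarrow> \<infinity>\<close>, so the two identities \<open>L\<close> and \<open>R\<close> are combined for partial sums, where
  \<open>A\<close> cancels up to boundary terms that vanish in the limit.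
\<close>

lemma green_rec: "(of_int x - s) * green s x = (of_int x - 1 + s) * green s (x - 1)"
proof -
  define t where "t x k = rising_coeff s k * srw_power k x" for x k
  define A where "A x n = (\<Sum>k<n. real k * t x k)" for x n
  define B where "B x n = (\<Sum>k<n. t x k)" for x n
  \<comment> \<open>The position factor is turned into \<open>Suc k\<close> by
    \<open>srw_power_Suc_left\<close>, and \<open>rising_coeff_Suc\<close> then absorbs
    that.\<close>
  have l: "(real (Suc k) + of_int y) * t y (Suc k) = (real k + s) * t (y - 1) k" for y k
  proof -
    have "(real (Suc k) + of_int y) * t y (Suc k) = rising_coeff s (Suc k) * ((real (Suc k) + of_int y) * srw_power (Suc k) y)"
      by (simp add: t_def del: srw_power.simps of_nat_Suc)
    also have "\<dots> = (real (Suc k) * rising_coeff s (Suc k)) * srw_power k (y - 1)"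
      unfolding srw_power_Suc_left by (simp del: of_nat_Suc)
    finally show ?thesis unfolding rising_coeff_Suc by (simp add: t_def)
  qed
  have r: "(real (Suc k) - of_int y) * t y (Suc k) = (real k + s) * t (y + 1) k" for y k
  proof -
    have "(real (Suc k) - of_int y) * t y (Suc k) = rising_coeff s (Suc k) * ((real (Suc k) - of_int y) * srw_power (Suc k) y)"
      by (simp add: t_def del: srw_power.simps of_nat_Suc)
    also have "\<dots> = (real (Suc k) * rising_coeff s (Suc k)) * srw_power k (y + 1)"
      unfolding srw_power_Suc_right by (simp del: of_nat_Suc)
    finally show ?thesis unfolding rising_coeff_Suc by (simp add: t_def)
  qed
  \<comment> \<open>Either \<open>y = 0\<close> or the walk of length 0 is not at \<open>y\<close>;
    the term \<open>k = 0\<close> thus drops out of the shifted sums.\<close>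
  have t0: "of_int y * t y 0 = 0" for y by (simp add: t_def)
  have L: "A y (Suc n) + of_int y * B y (Suc n) = A (y - 1) n + s * B (y - 1) n" for y n
  proof -
    have "A y (Suc n) + of_int y * B y (Suc n) = (\<Sum>k<Suc n. (real k + of_int y) * t y k)"
      by (simp add: A_def B_def sum_distrib_left sum.distrib distrib_right del: sum.lessThan_Suc)
    also have "\<dots> = (\<Sum>k<n. (real k + s) * t (y - 1) k)"
      unfolding sum.lessThan_Suc_shift l using t0[of y] by simp
    finally show ?thesis by (simp add: A_def B_def sum_distrib_left sum.distrib distrib_right)
  qed
  have R: "A y (Suc n) - of_int y * B y (Suc n) = A (y + 1) n + s * B (y + 1) n" for y n
  proof -
    have "A y (Suc n) - of_int y * B y (Suc n) = (\<Sum>k<Suc n. (real k - of_int y) * t y k)"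
      by (simp add: A_def B_def sum_distrib_left sum_subtractf left_diff_distrib del: sum.lessThan_Suc)
    also have "\<dots> = (\<Sum>k<n. (real k + s) * t (y + 1) k)"
      unfolding sum.lessThan_Suc_shift r using t0[of y] by simp
    finally show ?thesis by (simp add: A_def B_def sum_distrib_left sum.distrib distrib_right)
  qed
  have E: "real n * t x n + real n * t (x - 1) n + (of_int x * B x (Suc n) + s * B x n)
      = (of_int x - 1) * B (x - 1) (Suc n) + s * B (x - 1) n + 2 * (s * B x n)" for n
    using L[of x n] R[of "x - 1" n] by (simp add: A_def)
  \<comment> \<open>The boundary terms are at most of order
    \<open>n powr (s - 1 / 2)\<close>.\<close>
  have lim: "(\<lambda>n. real n * t y n) \<longlonglongrightarrow> 0" for y
  proof (rule tendsto_sandwich[OF always_eventually always_eventually tendsto_const])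
    show "\<forall>n. 0 \<le> real n * t y n" using green_term_nonneg by (simp add: t_def)
    show "\<forall>n. real n * t y n \<le> real n * (real n + s) powr (s - 3 / 2)"
      unfolding t_def using s rising_coeff_srw_power_le[of s _ y] by (intro allI mult_left_mono) auto
    show "(\<lambda>n. real n * (real n + s) powr (s - 3 / 2)) \<longlonglongrightarrow> 0"
      using s by real_asymp
  qed
  have B: "(\<lambda>n. B y n) \<longlonglongrightarrow> green s y" for y
    using summable_LIMSEQ[OF summable_green[of y]] by (simp add: B_def t_def green_def)
  note B' = LIMSEQ_Suc[OF B]
  have "(\<lambda>n. real n * t x n + real n * t (x - 1) n + (of_int x * B x (Suc n) + s * B x n))
      \<longlonglongrightarrow> 0 + 0 + (of_int x * green s x + s * green s x)"
    by (intro tendsto_intros lim B B')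
  moreover have "(\<lambda>n. (of_int x - 1) * B (x - 1) (Suc n) + s * B (x - 1) n + 2 * (s * B x n))
      \<longlonglongrightarrow> (of_int x - 1) * green s (x - 1) + s * green s (x - 1) + 2 * (s * green s x)"
    by (intro tendsto_intros B B')
  ultimately have "0 + 0 + (of_int x * green s x + s * green s x)
      = (of_int x - 1) * green s (x - 1) + s * green s (x - 1) + 2 * (s * green s x)"
    unfolding E by (rule LIMSEQ_unique)
  then show ?thesis by (simp add: algebra_simps)
qed

text \<open>By \<open>green_rec\<close>, one step to the right multiplies the Green function by
  \<open>1 - (1 - 2 * s) / y\<close>, and the lower bounds for these factors telescope. The step
  from 0 to 1 has \<open>y = 1 - s < 1\<close>, outside the range of
  \<open>one_minus_ge_powr\<close>; it is done by hand and leaves the factor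
  \<open>s / (1 - s)\<close>.\<close>

lemma green_nat_ge: "((1 - s) / (real n + 1 - s)) powr (1 - 2 * s) * (s / (1 - s)) \<le> green s (int (Suc n))"
proof (induction n)
  case 0
  have "(1 - s) * green s 1 = s * green s 0" using green_rec[of 1] by simp
  also have "\<dots> \<ge> s * 1" using green_0_ge s by (intro mult_left_mono) auto
  finally show ?case using s by (simp add: field_simps)
next
  case (Suc n)
  define y where "y = real n + 2 - s"
  have y: "y > 1" using s by (simp add: y_def)
  have "((1 - s) / (real (Suc n) + 1 - s)) powr (1 - 2 * s) * (s / (1 - s)) 
      = ((y - 1) / y) powr (1 - 2 * s) * (((1 - s) / (real n + 1 - s)) powr (1 - 2 * s) * (s / (1 - s)))"
  proof -
    have "(1 - s) / (real (Suc n) + 1 - s) = (y - 1) / y * ((1 - s) / (real n + 1 - s))"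
      using s y by (simp add: y_def add.commute add_diff_eq divide_simps)
    then show ?thesis by (simp only: powr_mult mult.assoc)
  qed
  also have "\<dots> \<le> (1 - (1 - 2 * s) / y) * green s (int (Suc n))"
    using s y Suc.IH one_minus_ge_powr[of "1 - 2 * s" y] 
    by (intro mult_mono) (auto intro: order_trans[of 0 "((y - 1) / y) powr (1 - 2 * s)"])
  also have "\<dots> = green s (int (Suc (Suc n)))"
    using green_rec[of "int (Suc (Suc n))"] s y by (simp add: y_def field_simps)
  finally show ?case .
qed

text \<open>The same product, bounded above by \<open>one_minus_le_powr\<close>, which applies from
  the first step on.\<close>

lemma green_nat_le: "green s (int n) \<le> green s 0 * (s / (real n + s)) powr (1 - 2 * s)"
proof (induction n)
  case (Suc n)
  define y where "y = real n + 1 - s"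
  have y: "y > 1 - 2 * s" "y > 0" using s by (auto simp: y_def)
  have pos: "green s (int n) \<ge> 0" unfolding green_def by (intro suminf_nonneg summable_green green_term_nonneg)
  have "green s (int (Suc n)) = (1 - (1 - 2 * s) / y) * green s (int n)"
    using green_rec[of "int (Suc n)"] s y by (simp add: y_def field_simps)
  also have "\<dots> \<le> ((y - (1 - 2 * s)) / (y - (1 - 2 * s) + 1)) powr (1 - 2 * s) 
      * (green s 0 * (s / (real n + s)) powr (1 - 2 * s))"
    using s y Suc.IH one_minus_le_powr[of "1 - 2 * s" y] pos by (intro mult_mono) auto
  also have "\<dots> = green s 0 * (((real n + s) / (real (Suc n) + s)) * (s / (real n + s))) powr (1 - 2 * s)"
  proof -
    have "y - (1 - 2 * s) = real n + s" "y - (1 - 2 * s) + 1 = real (Suc n) + s"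
      by (auto simp: y_def)
    then show ?thesis by (simp only: powr_mult mult.left_commute)
  qed
  also have "((real n + s) / (real (Suc n) + s)) * (s / (real n + s)) = s / (real (Suc n) + s)"
    using s by simp
  finally show ?case .
qed (use s in auto)

end

subsection \<open>The stable walk\<close>

fun srw_pmf :: "nat \<Rightarrow> int pmf" where
  "srw_pmf 0 = return_pmf 0"
| "srw_pmf (Suc k) = bind_pmf (pmf_of_set {-1, 1}) (\<lambda>e. map_pmf (\<lambda>d. e + d) (srw_pmf k))"

lemma pmf_srw_pmf: "pmf (srw_pmf k) d = srw_power k d"
proof (induction k arbitrary: d)
  case (Suc k)
  have "pmf (map_pmf (\<lambda>d. e + d) (srw_pmf k)) d = srw_power k (d - e)" for e
    using pmf_map_inj'[of "\<lambda>d. e + d" "srw_pmf k" "d - e"] Suc.IH by (simp add: inj_def)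
  then show ?case by (simp add: pmf_bind_pmf_of_set algebra_simps)
qed (simp add: indicator_def)

text \<open>Chapman-Kolmogorov; the sign in \<open>x + d\<close> is harmless because the steps are
  symmetric.\<close>

lemma nn_integral_srw_pmf_srw_power:
  "(\<integral>\<^sup>+d. ennreal (srw_power k (x + d)) \<partial>srw_pmf j) = ennreal (srw_power (j + k) x)"
proof (induction j arbitrary: x)
  case (Suc j)
  have "(\<integral>\<^sup>+d. ennreal (srw_power k (x + d)) \<partial>srw_pmf (Suc j)) 
     = (\<Sum>e\<in>{-1, 1}. \<integral>\<^sup>+d. ennreal (srw_power k ((x + e) + d)) \<partial>srw_pmf j) / 2"
    by (simp add: nn_integral_pmf_of_set add.assoc)
  also have "\<dots> = (\<Sum>e\<in>{-1, 1}. ennreal (srw_power (j + k) (x + e))) / 2"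
    unfolding Suc.IH ..
  also have "\<dots> = ennreal (srw_power (Suc j + k) x)"
    by (simp add: srw_power_nonneg divide_ennreal flip: ennreal_plus ennreal_numeral)
  finally show ?case .
qed simp

text \<open>Subordination: a stable step is a simple walk run for a random time. This is the law of
  that time minus one, as the coefficient with index 0 is -1 and has to be skipped.\<close>

definition stable_count :: "real \<Rightarrow> nat pmf" where
  "stable_count \<alpha> = embed_pmf (\<lambda>k. stable_coeff \<alpha> (Suc k))"

definition stable_pmf :: "real \<Rightarrow> int pmf" where
  "stable_pmf \<alpha> = bind_pmf (stable_count \<alpha>) (\<lambda>k. srw_pmf (Suc k))"

context
  fixes \<alpha> :: real
  assumes \<alpha>: "0 < \<alpha>" "\<alpha> < 1"
begin

lemma pmf_stable_count: "pmf (stable_count \<alpha>) k = stable_coeff \<alpha> (Suc k)"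
  unfolding stable_count_def
proof (rule pmf_embed_pmf)
  show nn: "0 \<le> stable_coeff \<alpha> (Suc k)" for k
    using \<alpha> by (intro stable_coeff_Suc_nonneg) auto
  have "(\<lambda>k. stable_coeff \<alpha> (Suc k)) sums 1" using \<alpha> by (intro sums_stable_coeff) auto
  then show "(\<integral>\<^sup>+k. ennreal (stable_coeff \<alpha> (Suc k)) \<partial>count_space UNIV) = 1"
    using suminf_ennreal_eq[OF nn] by (simp add: nn_integral_count_space_nat)
qed

lemma nn_integral_stable_count:
  "(\<integral>\<^sup>+k. f k \<partial>stable_count \<alpha>) = (\<Sum>k. ennreal (stable_coeff \<alpha> (Suc k)) * f k)"
  by (simp add: nn_integral_measure_pmf pmf_stable_count nn_integral_count_space_nat)

lemma pmf_stable_pmf: "pmf (stable_pmf \<alpha>) d = stable_kernel \<alpha> d"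
proof -
  have "pmf (stable_pmf \<alpha>) d = (\<integral>k. srw_power (Suc k) d \<partial>stable_count \<alpha>)"
    by (simp only: stable_pmf_def pmf_bind pmf_srw_pmf)
  also have "\<dots> = (\<integral>k. stable_coeff \<alpha> (Suc k) * srw_power (Suc k) d \<partial>count_space UNIV)"
    unfolding measure_pmf_eq_density
    by (subst integral_density) (use \<alpha> stable_coeff_Suc_nonneg[of \<alpha>] in \<open>auto simp: pmf_stable_count simp del: srw_power.simps\<close>)
  also have "\<dots> = stable_kernel \<alpha> d"
    unfolding stable_kernel_def
  proof (rule integral_count_space_nat)
    have s: "summable (\<lambda>k. stable_coeff \<alpha> (Suc k))"
      using sums_stable_coeff[of \<alpha>] \<alpha> by (auto simp: sums_iff)
    have "norm (stable_coeff \<alpha> (Suc k) * srw_power (Suc k) d) \<le> stable_coeff \<alpha> (Suc k)" for k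
      using stable_coeff_Suc_nonneg[of \<alpha> k] \<alpha> srw_power_nonneg[of "Suc k" d]
        pmf_le_1[of "srw_pmf (Suc k)" d, unfolded pmf_srw_pmf]
      by (simp add: abs_mult mult_left_le del: srw_power.simps)
    then have "summable (\<lambda>k. norm (stable_coeff \<alpha> (Suc k) * srw_power (Suc k) d))"
      by (intro summable_comparison_test'[OF s, of 0]) auto
    then show "integrable (count_space UNIV) (\<lambda>k. stable_coeff \<alpha> (Suc k) * srw_power (Suc k) d)"
      by (simp add: integrable_count_space_nat_iff)
  qed
  finally show ?thesis .
qed

lemma stable_step_eq: "stable_step \<alpha> = measure_pmf (stable_pmf \<alpha>)"
  by (simp add: stable_step_def measure_pmf_eq_density pmf_stable_pmf)

text \<open>A single simple step already has probability \<alpha>/2. This is the irreducibility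
  needed for the maximum principle.\<close>

lemma pmf_stable_pmf_1_pos: "0 < pmf (stable_pmf \<alpha>) 1"
proof -
  have "0 < pmf (stable_count \<alpha>) 0"
    using \<alpha> by (simp add: pmf_stable_count stable_coeff_def)
  moreover have "0 < pmf (srw_pmf (Suc 0)) 1"
    unfolding pmf_srw_pmf by simp
  ultimately have "1 \<in> set_pmf (stable_pmf \<alpha>)"
    unfolding stable_pmf_def set_bind_pmf by (auto simp: set_pmf_iff intro!: bexI[of _ 0])
  then show ?thesis by (simp add: pmf_positive)
qed

text \<open>Coefficients of
  \<open>(1 - (1 - z)^s) * (1 - z)^(-s) = (1 - z)^(-s) - 1\<close>.\<close>

lemma stable_coeff_convolution:
  "(\<Sum>j<n. stable_coeff \<alpha> (Suc j) * rising_coeff (\<alpha> / 2) (n - Suc j)) 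
     = rising_coeff (\<alpha> / 2) n - (if n = 0 then 1 else 0)"
proof -
  have "(\<Sum>j\<le>n. rising_coeff (- (\<alpha> / 2)) j * rising_coeff (\<alpha> / 2) (n - j))
    = rising_coeff (\<alpha> / 2) n + (\<Sum>j<n. rising_coeff (- (\<alpha> / 2)) (Suc j) * rising_coeff (\<alpha> / 2) (n - Suc j))"
    by (simp add: sum.atMost_shift)
  then show ?thesis
    using rising_coeff_convolution[of "\<alpha> / 2" n] by (simp add: stable_coeff_eq sum_negf split: if_splits)
qed

lemma ennreal_green: "ennreal (green (\<alpha> / 2) x) = (\<Sum>k. ennreal (rising_coeff (\<alpha> / 2) k * srw_power k x))"
  unfolding green_def using \<alpha>
  by (intro suminf_ennreal2[symmetric] green_term_nonneg summable_green) auto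

lemma green_nonneg: "0 \<le> green (\<alpha> / 2) x"
  unfolding green_def using \<alpha> by (intro suminf_nonneg summable_green green_term_nonneg) auto

text \<open>The Green function inverts \<open>I - P_\<alpha>\<close>. Working in
  \<open>ennreal\<close>, with the point mass added on the left, permits exchanging sums freely and
  avoids subtraction.\<close>

lemma nn_integral_green:
  "(\<integral>\<^sup>+d. ennreal (green (\<alpha> / 2) (x + d)) \<partial>stable_pmf \<alpha>) + (if x = 0 then 1 else 0) = ennreal (green (\<alpha> / 2) x)"
proof -
  let ?a = "rising_coeff (\<alpha> / 2)" and ?c = "\<lambda>j. stable_coeff \<alpha> (Suc j)" and ?p = "\<lambda>k. srw_power k x"
  have a: "0 \<le> ?a k" for k using \<alpha> by (intro rising_coeff_nonneg) auto
  have c: "0 \<le> ?c k" for k using \<alpha> by (intro stable_coeff_Suc_nonneg) auto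
  have p: "0 \<le> srw_power k y" for k y by (rule srw_power_nonneg)
  have "(\<integral>\<^sup>+d. ennreal (green (\<alpha> / 2) (x + d)) \<partial>stable_pmf \<alpha>) 
      = (\<integral>\<^sup>+j. (\<Sum>k. \<integral>\<^sup>+d. ennreal (?a k * srw_power k (x + d)) \<partial>srw_pmf (Suc j)) \<partial>stable_count \<alpha>)"
    unfolding stable_pmf_def nn_integral_bind_pmf ennreal_green
    by (subst nn_integral_suminf) auto
  also have "\<dots> = (\<integral>\<^sup>+j. (\<Sum>k. ennreal (?a k * ?p (Suc j + k))) \<partial>stable_count \<alpha>)"
    by (simp add: ennreal_mult a p nn_integral_cmult nn_integral_srw_pmf_srw_power 
        del: srw_pmf.simps srw_power.simps add_Suc)
  \<comment> \<open>Regrouping by the total number \<open>n = Suc j + k\<close> of simple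
    steps.\<close>
  also have "\<dots> = (\<integral>\<^sup>+j. (\<Sum>n. ennreal (if j < n then ?a (n - Suc j) * ?p n else 0)) \<partial>stable_count \<alpha>)"
  proof (intro nn_integral_cong)
    fix j
    show "(\<Sum>k. ennreal (?a k * ?p (Suc j + k))) = (\<Sum>n. ennreal (if j < n then ?a (n - Suc j) * ?p n else 0))"
      by (subst (2) suminf_offset[where i = "Suc j"]) (auto simp: add.commute simp del: srw_power.simps)
  qed
  also have "\<dots> = (\<Sum>j n. ennreal (if j < n then ?c j * ?a (n - Suc j) * ?p n else 0))"
    unfolding nn_integral_stable_count ennreal_suminf_cmult[symmetric]
    by (intro suminf_cong) (auto simp: ennreal_mult a c p mult.assoc)
  also have "\<dots> = (\<Sum>n j. ennreal (if j < n then ?c j * ?a (n - Suc j) * ?p n else 0))"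
    using nn_integral_suminf[of "\<lambda>n j. ennreal (if j < n then ?c j * ?a (n - Suc j) * ?p n else 0)" "count_space UNIV"]
    by (simp only: nn_integral_count_space_nat borel_measurable_count_space)
  also have "\<dots> = (\<Sum>n. ennreal ((\<Sum>j<n. ?c j * ?a (n - Suc j)) * ?p n))"
  proof (intro suminf_cong)
    fix n
    have "(\<Sum>j. ennreal (if j < n then ?c j * ?a (n - Suc j) * ?p n else 0)) 
      = (\<Sum>j<n. ennreal (?c j * ?a (n - Suc j) * ?p n))"
      by (subst suminf_finite[of "{..<n}"]) auto
    then show "(\<Sum>j. ennreal (if j < n then ?c j * ?a (n - Suc j) * ?p n else 0)) 
      = ennreal ((\<Sum>j<n. ?c j * ?a (n - Suc j)) * ?p n)"
      by (simp add: a c p sum_distrib_right)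
  qed
  finally have *: "(\<integral>\<^sup>+d. ennreal (green (\<alpha> / 2) (x + d)) \<partial>stable_pmf \<alpha>) 
      = (\<Sum>n. ennreal ((?a n - (if n = 0 then 1 else 0)) * ?p n))"
    unfolding stable_coeff_convolution .
  \<comment> \<open>The point mass is the term \<open>n = 0\<close> missing from the
    convolution.\<close>
  have "(if x = 0 then 1 else 0) = (\<Sum>n. ennreal ((if n = 0 then 1 else 0) * ?p n))"
    by (subst suminf_finite[of "{0}"]) auto
  then have "(\<integral>\<^sup>+d. ennreal (green (\<alpha> / 2) (x + d)) \<partial>stable_pmf \<alpha>) + (if x = 0 then 1 else 0)
      = (\<Sum>n. ennreal ((?a n - (if n = 0 then 1 else 0)) * ?p n) + ennreal ((if n = 0 then 1 else 0) * ?p n))"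
    unfolding * by (simp only: suminf_add[OF summableI summableI])
  also have "\<dots> = (\<Sum>n. ennreal (?a n * ?p n))"
    by (intro suminf_cong) (auto simp: a p algebra_simps simp flip: ennreal_plus)
  finally show ?thesis by (simp only: ennreal_green)
qed

lemma integral_green:
  shows "integrable (stable_pmf \<alpha>) (\<lambda>d. green (\<alpha> / 2) (x + d))"
    and "(\<integral>d. green (\<alpha> / 2) (x + d) \<partial>stable_pmf \<alpha>) = green (\<alpha> / 2) x - (if x = 0 then 1 else 0)"
proof -
  have "(\<integral>\<^sup>+d. ennreal (green (\<alpha> / 2) (x + d)) \<partial>stable_pmf \<alpha>) \<le> ennreal (green (\<alpha> / 2) x)"
    unfolding nn_integral_green[of x, symmetric] by simp
  then have le: "(\<integral>\<^sup>+d. ennreal (green (\<alpha> / 2) (x + d)) \<partial>stable_pmf \<alpha>) < \<infinity>"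
    by (rule le_less_trans) simp
  show i: "integrable (stable_pmf \<alpha>) (\<lambda>d. green (\<alpha> / 2) (x + d))"
    using le green_nonneg by (intro integrableI_nonneg) auto
  have "ennreal (\<integral>d. green (\<alpha> / 2) (x + d) \<partial>stable_pmf \<alpha>) + ennreal (if x = 0 then 1 else 0) = ennreal (green (\<alpha> / 2) x)"
    using nn_integral_green[of x] nn_integral_eq_integral[OF i] green_nonneg by (auto split: if_splits)
  then have "ennreal ((\<integral>d. green (\<alpha> / 2) (x + d) \<partial>stable_pmf \<alpha>) + (if x = 0 then 1 else 0)) = ennreal (green (\<alpha> / 2) x)"
    by (subst ennreal_plus) (auto intro!: Bochner_Integration.integral_nonneg green_nonneg)
  then have "(\<integral>d. green (\<alpha> / 2) (x + d) \<partial>stable_pmf \<alpha>) + (if x = 0 then 1 else 0) = green (\<alpha> / 2) x"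
    by (subst (asm) ennreal_inj) (auto intro!: add_nonneg_nonneg Bochner_Integration.integral_nonneg green_nonneg)
  then show "(\<integral>d. green (\<alpha> / 2) (x + d) \<partial>stable_pmf \<alpha>) = green (\<alpha> / 2) x - (if x = 0 then 1 else 0)"
    by simp
qed

end

subsection \<open>Escape probabilities\<close>

definition escape_function :: "real \<Rightarrow> int set \<Rightarrow> (int \<Rightarrow> real) \<Rightarrow> bool" where
  "escape_function \<alpha> B f \<longleftrightarrow> (\<forall>x. 0 \<le> f x \<and> f x \<le> 1) \<and> (\<forall>x\<in>B. f x = 0) \<and>
     (\<forall>x. x \<notin> B \<longrightarrow> f x = (\<integral>d. f (x + d) \<partial>stable_pmf \<alpha>))"

lemma measurable_partial_sum:
  "(\<lambda>\<omega>. \<Sum>i<n. \<omega> i) \<in> measurable (PiM UNIV (\<lambda>_::nat. measure_pmf K)) (count_space (UNIV :: int set))"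
proof (induction n)
  case (Suc n)
  let ?S = "PiM UNIV (\<lambda>_::nat. measure_pmf K)"
  have c: "(\<lambda>\<omega>. \<omega> n) \<in> measurable ?S (count_space UNIV)"
    using measurable_component_singleton[of n UNIV "\<lambda>_. measure_pmf K"]
    by (simp cong: measurable_cong_sets)
  have "(\<lambda>\<omega>. a + \<omega> n) \<in> measurable ?S (count_space UNIV)" for a
    using measurable_compose[OF c, of "\<lambda>z. a + z"] by simp
  then show ?case
    using measurable_compose_countable[OF _ Suc.IH, of "\<lambda>a \<omega>. a + \<omega> n"] by simp
qed simp

text \<open>Conditioning on the first increment: by \<open>PiM_iter\<close>, prepending an
  independent step to an increment sequence preserves the path measure.\<close>

lemma escape_function_prob:
  fixes \<alpha> :: real
  defines "S \<equiv> PiM UNIV (\<lambda>_::nat. measure_pmf (stable_pmf \<alpha>))"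
  shows "escape_function \<alpha> B (\<lambda>x. measure S {\<omega>\<in>space S. \<forall>n. x + (\<Sum>i<n. \<omega> i) \<notin> B})"
proof -
  interpret sequence_space "measure_pmf (stable_pmf \<alpha>)"
    by unfold_locales
  let ?M = "measure_pmf (stable_pmf \<alpha>)"
  define E where "E x = {\<omega>\<in>space S. \<forall>n. x + (\<Sum>i<n. \<omega> i) \<notin> B}" for x
  have S: "prob_space S" unfolding S_def by (intro prob_space_PiM measure_pmf.prob_space_axioms)
  interpret S: prob_space S by (rule S)
  have "{\<omega>\<in>space S. x + (\<Sum>i<n. \<omega> i) \<notin> B} \<in> sets S" for x n
    using measurable_sets[OF measurable_partial_sum[where n = n and K = "stable_pmf \<alpha>"], of "{z. x + z \<notin> B}"]
    by (simp add: S_def vimage_def Int_def conj_commute)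
  then have E: "E x \<in> sets S" for x
    unfolding E_def by (intro sets.sets_Collect_countable_All)
  have rec: "emeasure S (E x) = (\<integral>\<^sup>+d. emeasure S (E (x + d)) \<partial>?M)" if "x \<notin> B" for x
  proof -
    let ?f = "\<lambda>(s, \<omega>). case_nat s \<omega>"
    have f: "?f \<in> measurable (?M \<Otimes>\<^sub>M S) S"
      unfolding S_def by measurable
    have "emeasure S (E x) = emeasure (distr (?M \<Otimes>\<^sub>M S) S ?f) (E x)"
      using PiM_iter by (simp add: S_def)
    also have "\<dots> = emeasure (?M \<Otimes>\<^sub>M S) (?f -` E x \<inter> space (?M \<Otimes>\<^sub>M S))"
      by (rule emeasure_distr[OF f E])
    also have "\<dots> = (\<integral>\<^sup>+d. emeasure S (Pair d -` (?f -` E x \<inter> space (?M \<Otimes>\<^sub>M S))) \<partial>?M)"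
      by (intro S.emeasure_pair_measure_alt measurable_sets[OF f E])
    also have "\<dots> = (\<integral>\<^sup>+d. emeasure S (E (x + d)) \<partial>?M)"
    proof (intro nn_integral_cong arg_cong[where f = "emeasure S"])
      fix d :: int
      have shift: "(\<Sum>i<Suc n. case_nat d \<omega> i) = d + (\<Sum>i<n. \<omega> i)" for n and \<omega> :: "nat \<Rightarrow> int"
        by (simp add: sum.lessThan_Suc_shift del: sum.lessThan_Suc)
      \<comment> \<open>The instance \<open>n = 0\<close> on the left is the assumption that
        \<open>x\<close> lies outside \<open>B\<close>; the others shift by one.\<close>
      have "(\<forall>n. x + (\<Sum>i<n. case_nat d \<omega> i) \<notin> B) \<longleftrightarrow> (\<forall>n. x + d + (\<Sum>i<n. \<omega> i) \<notin> B)" 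
        (is "?l \<longleftrightarrow> ?r") for \<omega> :: "nat \<Rightarrow> int"
      proof
        assume ?l
        then have "x + (\<Sum>i<Suc n. case_nat d \<omega> i) \<notin> B" for n by blast
        then show ?r unfolding shift by (simp add: add.assoc)
      next
        assume r: ?r
        show ?l
        proof
          fix n
          show "x + (\<Sum>i<n. case_nat d \<omega> i) \<notin> B"
          proof (cases n)
            case (Suc m)
            then show ?thesis using r shift[of \<omega> m] by (simp add: add.assoc del: sum.lessThan_Suc)
          qed (use that in simp)
        qed
      qed
      then show "Pair d -` (?f -` E x \<inter> space (?M \<Otimes>\<^sub>M S)) = E (x + d)"
        by (auto simp: E_def space_pair_measure S_def space_PiM PiE_UNIV_domain)
    qed
    finally show ?thesis .
  qed
  have "S.prob (E x) = (\<integral>d. S.prob (E (x + d)) \<partial>?M)" if "x \<notin> B" for x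
  proof -
    have "ennreal (S.prob (E x)) = (\<integral>\<^sup>+d. ennreal (S.prob (E (x + d))) \<partial>?M)"
      using rec[OF that] by (simp add: S.emeasure_eq_measure)
    also have "\<dots> = ennreal (\<integral>d. S.prob (E (x + d)) \<partial>?M)"
      by (intro nn_integral_eq_integral measure_pmf.integrable_const_bound[where B = 1]) auto
    finally show ?thesis
      by (subst (asm) ennreal_inj) (auto intro!: Bochner_Integration.integral_nonneg)
  qed
  moreover have "S.prob (E x) = 0" if "x \<in> B" for x
  proof -
    have "E x = {}" unfolding E_def using that by (auto intro!: exI[of _ "0::nat"])
    then show ?thesis by simp
  qed
  ultimately show ?thesis
    unfolding escape_function_def E_def[symmetric] by auto
qed

lemma stable_massiveI:
  assumes \<alpha>: "0 < \<alpha>" "\<alpha> < 1" and z: "\<And>f x. escape_function \<alpha> B f \<Longrightarrow> f x = 0"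
  shows "stable_massive \<alpha> B"
  unfolding stable_massive_def
proof
  fix x
  define S where "S = PiM UNIV (\<lambda>_::nat. measure_pmf (stable_pmf \<alpha>))"
  interpret S: prob_space S
    unfolding S_def by (intro prob_space_PiM measure_pmf.prob_space_axioms)
  have S: "stable_increments \<alpha> = S"
    by (simp add: stable_increments_def S_def stable_step_eq[OF \<alpha>])
  let ?H = "{\<omega>\<in>space S. \<exists>n. x + (\<Sum>i<n. \<omega> i) \<in> B}"
  have "{\<omega>\<in>space S. x + (\<Sum>i<n. \<omega> i) \<in> B} \<in> sets S" for n
    using measurable_sets[OF measurable_partial_sum[where n = n and K = "stable_pmf \<alpha>"], of "{z. x + z \<in> B}"]
    by (simp add: S_def vimage_def Int_def conj_commute)
  then have "?H \<in> sets S" by (intro sets.sets_Collect_countable_Ex)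
  moreover have "space S - ?H = {\<omega>\<in>space S. \<forall>n. x + (\<Sum>i<n. \<omega> i) \<notin> B}" by auto
  moreover have "S.prob {\<omega>\<in>space S. \<forall>n. x + (\<Sum>i<n. \<omega> i) \<notin> B} = 0"
    unfolding S_def by (rule z[OF escape_function_prob])
  ultimately show "measure (stable_increments \<alpha>) 
      {\<omega> \<in> space (stable_increments \<alpha>). \<exists>n. x + (\<Sum>i<n. \<omega> i) \<in> B} = 1"
    unfolding S using S.prob_compl[of ?H] by simp
qed

subsection \<open>Weighted potentials\<close>

lemma powr_minus_times_powr_minus_one:
  fixes x a :: real
  assumes "0 < x"
  shows "x powr (- a) * x powr (a - 1) = 1 / x"
proof -
  have "x powr (- a) * x powr (a - 1) = x powr (- 1)"
    unfolding powr_add[symmetric] by simp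
  then show ?thesis using assms by (simp add: powr_minus_divide)
qed

text \<open>The window lies in \<open>{1..<2*n}\<close>; on either side of \<open>n\<close> the
  values distance plus one run through distinct integers up to \<open>n\<close>.\<close>

lemma sum_inverse_powr_window_le:
  fixes n :: nat
  assumes "0 < a" "a \<le> 1" "finite T" "\<And>p. p \<in> T \<Longrightarrow> \<bar>int n - int p\<bar> < int n"
  shows "(\<Sum>p\<in>T. (\<bar>real n - real p\<bar> + 1) powr (a - 1)) \<le> 2 * real n powr a / a"
proof -
  let ?g = "\<lambda>p. (\<bar>real n - real p\<bar> + 1) powr (a - 1)"
  have "T \<subseteq> {1..n} \<union> {n+1..<2*n}" using assms(4) by force
  then have "sum ?g T \<le> sum ?g ({1..n} \<union> {n+1..<2*n})"
    by (intro sum_mono2) auto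
  also have "\<dots> = sum ?g {1..n} + sum ?g {n+1..<2*n}"
    by (intro sum.union_disjoint) auto
  also have "sum ?g {1..n} = (\<Sum>j=1..n. real j powr (a - 1))"
    by (rule sum.reindex_bij_witness[of _ "\<lambda>j. n + 1 - j" "\<lambda>p. n + 1 - p"]) (auto simp: of_nat_diff algebra_simps)
  also have "sum ?g {n+1..<2*n} = (\<Sum>j=2..n. real j powr (a - 1))"
    by (rule sum.reindex_bij_witness[of _ "\<lambda>j. n + j - 1" "\<lambda>p. p - n + 1"]) (auto simp: of_nat_diff algebra_simps)
  also have "\<dots> \<le> (\<Sum>j=1..n. real j powr (a - 1))"
    by (intro sum_mono2) auto
  also note sum_powr_le[OF assms(1,2), of n]
  finally show ?thesis using sum_powr_le[OF assms(1,2), of n] by simp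
qed

text \<open>The weight is chosen so that its product with \<open>p powr (a - 1)\<close> is
  \<open>1 / p\<close>. Points near \<open>x\<close> add only a constant, however dense
  \<open>A\<close> is there.\<close>

lemma weighted_potential_le:
  fixes a :: real and A :: "nat set" and x :: int
  assumes a: "0 < a" "a < 1" and A: "finite A" "\<And>p. p \<in> A \<Longrightarrow> 0 < p"
  shows "(\<Sum>p\<in>A. real p powr (- a) * (\<bar>of_int x - real p\<bar> + 1) powr (a - 1)) 
          \<le> 2 * (\<Sum>p\<in>A. 1 / real p) + 4 / a"
proof -
  \<comment> \<open>Off \<open>T\<close>, \<open>\<bar>x - p\<bar>\<close> is comparable to \<open>p\<close>; on \<open>T\<close>, \<open>p\<close> is comparable to \<open>x\<close>.\<close>
  define T where "T = {p\<in>A. 2 * \<bar>x - int p\<bar> < int p}"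
  let ?g = "\<lambda>p. (\<bar>of_int x - real p\<bar> + 1) powr (a - 1)"
  have far: "real p powr (- a) * ?g p \<le> 2 * (1 / real p)" if "p \<in> A" "p \<notin> T" for p
  proof -
    have p: "0 < p" "int p \<le> 2 * \<bar>x - int p\<bar>" using that A by (auto simp: T_def)
    then have "real_of_int (int p) \<le> real_of_int (2 * \<bar>x - int p\<bar>)"
      by (simp only: of_int_le_iff)
    then have "?g p \<le> (real p / 2) powr (a - 1)"
      using a p by (intro powr_mono2') auto
    also have "\<dots> = 2 powr (1 - a) * real p powr (a - 1)"
      using p by (simp add: powr_divide powr_minus_divide[of 2 "1 - a", simplified])
    also have "\<dots> \<le> 2 * real p powr (a - 1)"
      using a powr_mono[of "1 - a" 1 2] by (intro mult_right_mono) auto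
    finally have "real p powr (- a) * ?g p \<le> real p powr (- a) * (2 * real p powr (a - 1))"
      by (intro mult_left_mono) auto
    also have "\<dots> = 2 * (1 / real p)"
      using powr_minus_times_powr_minus_one[of "real p" a] p by simp
    finally show ?thesis .
  qed
  have near: "(\<Sum>p\<in>T. real p powr (- a) * ?g p) \<le> 4 / a"
  proof (cases "T = {}")
    case False
    then obtain q where "2 * \<bar>x - int q\<bar> < int q" by (auto simp: T_def)
    then have x: "x > 0" by (auto simp: abs_if split: if_splits)
    define n where "n = nat x"
    have n: "x = int n" "n > 0" using x by (auto simp: n_def)
    have "real p powr (- a) \<le> 2 * real n powr (- a)" if "p \<in> T" for p
    proof -
      have "2 * \<bar>x - int p\<bar> < int p" using that by (simp add: T_def)
      then have "n \<le> 2 * p" using n by (auto simp: abs_if split: if_splits)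
      then have "real n / 2 \<le> real p" by linarith
      then have "real p powr (- a) \<le> (real n / 2) powr (- a)"
        using n a by (intro powr_mono2') auto
      also have "\<dots> = 2 powr a * real n powr (- a)"
        using n by (simp add: powr_divide powr_minus_divide[of 2 a])
      also have "\<dots> \<le> 2 * real n powr (- a)"
        using a powr_mono[of a 1 2] by (intro mult_right_mono) auto
      finally show ?thesis .
    qed
    then have "(\<Sum>p\<in>T. real p powr (- a) * ?g p) \<le> (\<Sum>p\<in>T. 2 * real n powr (- a) * ?g p)"
      by (intro sum_mono mult_right_mono) auto
    also have "\<dots> = 2 * real n powr (- a) * (\<Sum>p\<in>T. ?g p)"
      by (simp add: sum_distrib_left)
    also have "\<dots> \<le> 2 * real n powr (- a) * (2 * real n powr a / a)"
    proof (intro mult_left_mono)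
      have "\<bar>int n - int p\<bar> < int n" if "p \<in> T" for p
      proof -
        have "2 * \<bar>x - int p\<bar> < int p" using that by (simp add: T_def)
        then show ?thesis using n by (auto simp: abs_if split: if_splits)
      qed
      then show "(\<Sum>p\<in>T. ?g p) \<le> 2 * real n powr a / a"
        using sum_inverse_powr_window_le[of a T n] a A n by (simp add: T_def)
    qed simp
    also have "\<dots> = 4 / a" using n by (simp add: powr_minus field_simps)
    finally show ?thesis .
  qed (use a in simp)
  have "(\<Sum>p\<in>A. real p powr (- a) * ?g p) 
      = (\<Sum>p\<in>A - T. real p powr (- a) * ?g p) + (\<Sum>p\<in>T. real p powr (- a) * ?g p)"
    using A by (intro sum.subset_diff) (auto simp: T_def)
  also have "\<dots> \<le> (\<Sum>p\<in>A - T. 2 * (1 / real p)) + 4 / a"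
    using far near by (intro add_mono sum_mono) auto
  also have "(\<Sum>p\<in>A - T. 2 * (1 / real p)) \<le> (\<Sum>p\<in>A. 2 * (1 / real p))"
    using A by (intro sum_mono2) auto
  finally show ?thesis by (simp add: sum_distrib_left)
qed

text \<open>Every point of \<open>A\<close> is so far out that its distance to \<open>x\<close> plus
  one is at most \<open>2 * p\<close>.\<close>

lemma weighted_potential_ge:
  fixes a :: real and A :: "nat set" and x :: int
  assumes a: "0 < a" "a < 1" and A: "finite A" "\<And>p. p \<in> A \<Longrightarrow> \<bar>x\<bar> + 1 \<le> int p"
  shows "(\<Sum>p\<in>A. 1 / real p) / 2
    \<le> (\<Sum>p\<in>A. real p powr (- a) * (\<bar>of_int x - real p\<bar> + 1) powr (a - 1))"
  unfolding sum_divide_distrib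
proof (rule sum_mono)
  fix p assume "p \<in> A"
  then have "\<bar>x\<bar> + 1 \<le> int p" by (rule A)
  then have p: "0 < real p" "\<bar>of_int x - real p\<bar> + 1 \<le> 2 * real p" by linarith+
  have "1 / real p / 2 = real p powr (- a) * (real p powr (a - 1) * 2 powr (- 1))"
  proof -
    have "real p powr (- a) * real p powr (a - 1) = 1 / real p"
      using p(1) by (rule powr_minus_times_powr_minus_one)
    then show ?thesis by (simp add: powr_minus_divide flip: mult.assoc)
  qed
  also have "\<dots> \<le> real p powr (- a) * (real p powr (a - 1) * 2 powr (a - 1))"
    using a by (intro mult_left_mono powr_mono) auto
  also have "\<dots> = real p powr (- a) * (2 * real p) powr (a - 1)"
    by (simp add: powr_mult)
  also have "\<dots> \<le> real p powr (- a) * (\<bar>of_int x - real p\<bar> + 1) powr (a - 1)"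
    using a p by (intro mult_left_mono powr_mono2') auto
  finally show "1 / real p / 2 \<le> real p powr (- a) * (\<bar>of_int x - real p\<bar> + 1) powr (a - 1)" .
qed

subsection \<open>Divergence of the sum of inverse primes\<close>

lemma prime_factors_eq_imp_eq_squarefree:
  fixes m n :: nat
  assumes "squarefree m" "squarefree n" "prime_factors m = prime_factors n"
  shows "m = n"
proof -
  have *: "k = \<Prod>(prime_factors k)" if "squarefree k" for k :: nat
  proof -
    have k: "k \<noteq> 0" using that by (metis not_squarefree_0)
    then have "k = (\<Prod>p\<in>prime_factors k. p ^ multiplicity p k)"
      using prod_prime_factors[OF k] by simp
    also have "\<dots> = \<Prod>(prime_factors k)"
      using that squarefree_factorial_semiring'[OF k] by (intro prod.cong) auto
    finally show ?thesis .
  qed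
  show ?thesis using *[of m] *[of n] assms by metis
qed

text \<open>Following Erdos: each \<open>m\<close> is a square times a product of distinct primes.\<close>

lemma card_smooth_le:
  fixes A :: "nat set"
  assumes "finite A"
  shows "real (card {m\<in>{1..n}. prime_factors m \<subseteq> A}) \<le> 2 ^ card A * sqrt n"
proof -
  let ?B = "{m\<in>{1..n}. prime_factors m \<subseteq> A}"
  define r where "r = nat \<lfloor>sqrt n\<rfloor>"
  \<comment> \<open>\<open>square_part m\<close> is the root of the square factor of
    \<open>m\<close>, hence at most \<open>sqrt n\<close>.\<close>
  let ?f = "\<lambda>m. (prime_factors (squarefree_part m), square_part m)"
  have inj: "inj_on ?f ?B"
  proof (rule inj_onI)
    fix a b :: nat assume *: "?f a = ?f b"
    have "squarefree_part a = squarefree_part b"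
      using * by (intro prime_factors_eq_imp_eq_squarefree squarefree_squarefree_part) simp
    moreover have "square_part a = square_part b" using * by simp
    ultimately show "a = b" by (metis squarefree_decompose)
  qed
  have sub: "?f ` ?B \<subseteq> Pow A \<times> {1..r}"
  proof
    fix z assume "z \<in> ?f ` ?B"
    then obtain m where z: "z = ?f m" and m: "1 \<le> m" "m \<le> n" "prime_factors m \<subseteq> A" by auto
    have "squarefree_part m dvd m" by (metis dvd_triv_left squarefree_decompose)
    then have "prime_factors (squarefree_part m) \<subseteq> A"
      using m dvd_prime_factors[of m "squarefree_part m"] by auto
    moreover have "square_part m ^ 2 \<le> n"
      using m dvd_imp_le[OF square_part_square_dvd, of m] by simp
    then have "real (square_part m) ^ 2 \<le> real n" by (metis of_nat_le_iff of_nat_power)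
    then have "square_part m \<le> r" by (simp add: r_def le_nat_floor real_le_rsqrt)
    moreover have "square_part m > 0" using m by (intro Nat.gr0I) auto
    ultimately show "z \<in> Pow A \<times> {1..r}" using z by auto
  qed
  have "card ?B \<le> card (Pow A \<times> {1..r})"
    using assms by (intro card_inj_on_le[OF inj sub]) simp
  then have "card ?B \<le> 2 ^ card A * r" using assms by (simp add: card_Pow card_cartesian_product)
  then have "real (card ?B) \<le> real (2 ^ card A * r)"
    by (rule of_nat_mono)
  also have "\<dots> = 2 ^ card A * real r" by simp
  also have "\<dots> \<le> 2 ^ card A * sqrt n"
    by (intro mult_left_mono) (auto simp: r_def)
  finally show ?thesis .
qed

text \<open>Otherwise fewer than half of \<open>{1..n}\<close> would have a prime factor outside
  \<open>A\<close>, leaving more numbers with all prime factors in \<open>A\<close> than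
  \<open>card_smooth_le\<close> allows.\<close>

lemma inverse_primes_tail:
  fixes A :: "nat set"
  assumes A: "finite A"
  shows "\<exists>F. finite F \<and> F \<subseteq> {p. prime p} \<and> F \<inter> A = {} \<and> (\<Sum>p\<in>F. 1 / real p) \<ge> 1 / 2"
proof (rule ccontr)
  assume "\<not> ?thesis"
  then have tail: "(\<Sum>p\<in>F. 1 / real p) < 1 / 2" 
    if "finite F" "F \<subseteq> {p. prime p}" "F \<inter> A = {}" for F
    using that by (meson not_le)
  \<comment> \<open>Large enough that \<open>sqrt n\<close> exceeds
    \<open>2 * 2 ^ card A\<close>.\<close>
  define n :: nat where "n = (2 * 2 ^ card A) ^ 2 + 1"
  have "n > 0" by (simp add: n_def)
  define F where "F = {p. prime p \<and> p \<le> n \<and> p \<notin> A}"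
  have F: "finite F" "F \<subseteq> {p. prime p}" "F \<inter> A = {}" by (auto simp: F_def)
  have sub: "{1..n} \<subseteq> {m\<in>{1..n}. prime_factors m \<subseteq> A} \<union> (\<Union>p\<in>F. {m\<in>{1..n}. p dvd m})"
  proof
    fix m assume m: "m \<in> {1..n}"
    show "m \<in> {m\<in>{1..n}. prime_factors m \<subseteq> A} \<union> (\<Union>p\<in>F. {m\<in>{1..n}. p dvd m})"
    proof (cases "prime_factors m \<subseteq> A")
      case False
      then obtain p where p: "prime p" "p dvd m" "p \<notin> A"
        by (auto simp: in_prime_factors_iff)
      moreover have "p \<le> n" using dvd_imp_le[OF p(2)] m by simp
      ultimately show ?thesis using m by (auto simp: F_def)
    qed (use m in simp)
  qed
  have "real n \<le> real (card ({m\<in>{1..n}. prime_factors m \<subseteq> A} \<union> (\<Union>p\<in>F. {m\<in>{1..n}. p dvd m})))"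
    using card_mono[OF _ sub] F by simp
  also have "\<dots> \<le> real (card {m\<in>{1..n}. prime_factors m \<subseteq> A}) + (\<Sum>p\<in>F. real (card {m\<in>{1..n}. p dvd m}))"
    using order_trans[OF card_Un_le add_left_mono[OF card_UN_le[OF F(1), of "\<lambda>p. {m\<in>{1..n}. p dvd m}"]]]
    by (simp flip: of_nat_sum of_nat_add)
  also have "\<dots> \<le> 2 ^ card A * sqrt n + (\<Sum>p\<in>F. real n * (1 / real p))"
  proof (intro add_mono sum_mono card_smooth_le A)
    fix p assume "p \<in> F"
    then have p: "p > 0" by (auto simp: F_def prime_gt_0_nat)
    have "{m\<in>{1..n}. p dvd m} \<subseteq> (\<lambda>k. p * k) ` {1..n div p}"
    proof
      fix m assume "m \<in> {m\<in>{1..n}. p dvd m}"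
      then obtain k where k: "m = p * k" "1 \<le> m" "m \<le> n" by auto
      then have "k \<le> n div p" "1 \<le> k"
        using p by (auto simp: less_eq_div_iff_mult_less_eq mult.commute Suc_le_eq)
      then show "m \<in> (\<lambda>k. p * k) ` {1..n div p}" using k(1) by auto
    qed
    then have "card {m\<in>{1..n}. p dvd m} \<le> card ((\<lambda>k. p * k) ` {1..n div p})"
      by (intro card_mono) auto
    also have "\<dots> \<le> n div p" using card_image_le[of "{1..n div p}" "\<lambda>k. p * k"] by simp
    finally show "real (card {m\<in>{1..n}. p dvd m}) \<le> real n * (1 / real p)"
      using of_nat_div_le_of_nat[of n p, where 'a = real] by simp
  qed
  also have "(\<Sum>p\<in>F. real n * (1 / real p)) = real n * (\<Sum>p\<in>F. 1 / real p)"
    by (simp add: sum_distrib_left)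
  also have "\<dots> < real n * (1/2)"
    using tail[OF F] \<open>n > 0\<close> by (intro mult_strict_left_mono) auto
  finally have "real n < 2 * 2 ^ card A * sqrt n" by simp
  then have "sqrt n * sqrt n < 2 * 2 ^ card A * sqrt n" by simp
  then have "sqrt n < 2 * 2 ^ card A" using \<open>n > 0\<close> by (subst (asm) mult_less_cancel_right_pos) auto
  then have "(sqrt n)\<^sup>2 < (2 * 2 ^ card A)\<^sup>2" by (intro power_strict_mono) auto
  then show False by (simp add: n_def)
qed

text \<open>Disjoint blocks of sum at least 1/2 are collected, each time excluding the primes
  already used.\<close>

theorem inverse_primes_unbounded:
  fixes A :: "nat set" and R :: real
  assumes "finite A"
  obtains F where "finite F" "F \<subseteq> {p. prime p}" "F \<inter> A = {}" "(\<Sum>p\<in>F. 1 / real p) \<ge> R"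
proof -
  have "\<exists>F. finite F \<and> F \<subseteq> {p. prime p} \<and> F \<inter> A = {} \<and> (\<Sum>p\<in>F. 1 / real p) \<ge> real n / 2" for n
  proof (induction n)
    case 0
    show ?case by (rule exI[of _ "{}"]) auto
  next
    case (Suc n)
    then obtain F where F: "finite F" "F \<subseteq> {p. prime p}" "F \<inter> A = {}"
      "(\<Sum>p\<in>F. 1 / real p) \<ge> real n / 2" by blast
    moreover obtain F' where F': "finite F'" "F' \<subseteq> {p. prime p}" "F' \<inter> (A \<union> F) = {}"
      "(\<Sum>p\<in>F'. 1 / real p) \<ge> 1 / 2"
      using inverse_primes_tail[of "A \<union> F"] F(1) assms by auto
    moreover have "(\<Sum>p\<in>F \<union> F'. 1 / real p) = (\<Sum>p\<in>F. 1 / real p) + (\<Sum>p\<in>F'. 1 / real p)"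
      using F(1) F'(1,3) by (intro sum.union_disjoint) auto
    ultimately show ?case by (intro exI[of _ "F \<union> F'"]) (auto simp: field_simps)
  qed
  from this[of "nat \<lceil>2 * R\<rceil>"] obtain F where "finite F" "F \<subseteq> {p. prime p}" "F \<inter> A = {}"
    and F: "(\<Sum>p\<in>F. 1 / real p) \<ge> real (nat \<lceil>2 * R\<rceil>) / 2" by blast
  moreover have "R \<le> real (nat \<lceil>2 * R\<rceil>) / 2" by linarith
  ultimately show ?thesis using that by force
qed

subsection \<open>Primes are massive\<close>

context
  fixes \<alpha> :: real
  assumes \<alpha>: "0 < \<alpha>" "\<alpha> < 1"
begin

section \<open>Two-sided decay of the Green function on all integers\<close>

lemma green_ge:
  obtains c where "0 < c" "\<And>x. c * (\<bar>of_int x\<bar> + 1) powr (\<alpha> - 1) \<le> green (\<alpha> / 2) x"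
proof -
  define s where "s = \<alpha> / 2"
  have s: "0 < s" "s < 1 / 2" using \<alpha> by (auto simp: s_def)
  \<comment> \<open>This is the constant of \<open>green_nat_ge\<close>. It is at most 1, which
    settles the origin, where the Green function is at least 1.\<close>
  define c where "c = (1 - s) powr (1 - \<alpha>) * (s / (1 - s))"
  have nat: "c * (real n + 1) powr (\<alpha> - 1) \<le> green s (int n)" for n
  proof (cases n)
    case 0
    have "(1 - s) powr (1 - \<alpha>) \<le> 1" using s \<alpha> by (intro powr_le1) auto
    then have "c \<le> 1 * 1" unfolding c_def using s by (intro mult_mono) auto
    then show ?thesis using green_0_ge[OF s] 0 by simp
  next
    case (Suc m)
    have "c * (real n + 1) powr (\<alpha> - 1) = ((1 - s) / (real m + 2)) powr (1 - \<alpha>) * (s / (1 - s))"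
      using s powr_minus_divide[of "real m + 2" "1 - \<alpha>"]
      by (simp add: c_def Suc powr_divide add.commute)
    also have "\<dots> \<le> ((1 - s) / (real m + 1 - s)) powr (1 - \<alpha>) * (s / (1 - s))"
      using s \<alpha> by (intro mult_right_mono powr_mono2 divide_left_mono mult_pos_pos) auto
    also have "\<dots> \<le> green s (int n)"
      using green_nat_ge[OF s, of m] by (simp add: s_def Suc)
    finally show ?thesis .
  qed
  have "c * (\<bar>of_int x\<bar> + 1) powr (\<alpha> - 1) \<le> green s x" for x
    using nat[of "nat \<bar>x\<bar>"] green_minus[OF s, of x] by (cases "x \<ge> 0") auto
  moreover have "0 < c" using s by (simp add: c_def)
  ultimately show ?thesis using that unfolding s_def by blast
qed

lemma green_le: "green (\<alpha> / 2) x \<le> green (\<alpha> / 2) 0 * (\<bar>of_int x\<bar> + 1) powr (\<alpha> - 1)"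
proof -
  define s where "s = \<alpha> / 2"
  have s: "0 < s" "s < 1 / 2" using \<alpha> by (auto simp: s_def)
  have nat: "green s (int n) \<le> green s 0 * (real n + 1) powr (\<alpha> - 1)" for n
  proof -
    have "s * (real n + 1) \<le> real n + s"
      using s mult_right_mono[of s 1 "real n"] by (simp add: algebra_simps)
    then have "s / (real n + s) \<le> 1 / (real n + 1)"
      using s by (simp add: field_simps)
    then have "(s / (real n + s)) powr (1 - \<alpha>) \<le> (1 / (real n + 1)) powr (1 - \<alpha>)"
      using s \<alpha> by (intro powr_mono2) auto
    also have "\<dots> = (real n + 1) powr (\<alpha> - 1)"
      using powr_minus_divide[of "real n + 1" "1 - \<alpha>"] by (simp add: powr_divide)
    finally have "green s 0 * (s / (real n + s)) powr (1 - \<alpha>) \<le> green s 0 * (real n + 1) powr (\<alpha> - 1)"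
      using green_0_ge[OF s] by (intro mult_left_mono) auto
    then show ?thesis using green_nat_le[OF s, of n] by (simp add: s_def)
  qed
  then show ?thesis
    using nat[of "nat \<bar>x\<bar>"] green_minus[OF s, of x] unfolding s_def[symmetric] by (cases "x \<ge> 0") auto
qed

lemma green_tendsto_0: "((\<lambda>x. green (\<alpha> / 2) (x - y)) \<longlongrightarrow> 0) cofinite"
proof -
  have "filterlim (\<lambda>x. \<bar>real_of_int (x - y)\<bar> + 1) at_top cofinite"
    unfolding filterlim_at_top
  proof
    fix Z :: real
    have "{x. \<not> Z \<le> \<bar>real_of_int (x - y)\<bar> + 1} \<subseteq> {y - \<lceil>Z\<rceil>..y + \<lceil>Z\<rceil>}"
      by (auto simp: not_le) linarith+
    then show "\<forall>\<^sub>F x in cofinite. Z \<le> \<bar>real_of_int (x - y)\<bar> + 1"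
      unfolding eventually_cofinite by (rule finite_subset) simp
  qed
  then have "((\<lambda>x. (\<bar>real_of_int (x - y)\<bar> + 1) powr (\<alpha> - 1)) \<longlongrightarrow> 0) cofinite"
    using \<alpha> by (intro tendsto_neg_powr) auto
  then have lim: "((\<lambda>x. green (\<alpha> / 2) 0 * (\<bar>real_of_int (x - y)\<bar> + 1) powr (\<alpha> - 1)) \<longlongrightarrow> 0) cofinite"
    by (rule tendsto_mult_right_zero)
  have "\<forall>x. norm (green (\<alpha> / 2) (x - y)) \<le> green (\<alpha> / 2) 0 * (\<bar>real_of_int (x - y)\<bar> + 1) powr (\<alpha> - 1)"
    using green_le[of "x - y" for x] green_nonneg[OF \<alpha>] by simp
  then show ?thesis
    by (rule Lim_null_comparison[OF always_eventually lim])
qed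

text \<open>A positive value would force a positive maximum, as \<open>F\<close> dominates
  \<open>D\<close> and vanishes at infinity. At a maximum \<open>D\<close> equals its mean, so it is
  maximal one step to the right as well; iterating gives infinitely many maxima, against the
  decay.\<close>

lemma maximum_principle:
  fixes D F :: "int \<Rightarrow> real"
  assumes le: "\<And>x. D x \<le> F x" and F: "(F \<longlongrightarrow> 0) cofinite"
    and int: "\<And>x. integrable (stable_pmf \<alpha>) (\<lambda>d. D (x + d))"
    and D: "\<And>x. D x \<le> 0 \<or> D x = (\<integral>d. D (x + d) \<partial>stable_pmf \<alpha>)"
  shows "D x \<le> 0"
proof (rule ccontr)
  assume "\<not> D x \<le> 0"
  define T where "T = {y. D x \<le> D y}"
  have "\<forall>\<^sub>F y in cofinite. F y < D x"
    using F \<open>\<not> D x \<le> 0\<close> by (intro order_tendstoD) auto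
  then have T: "finite T"
    unfolding eventually_cofinite T_def using le by (rule_tac finite_subset) (auto simp: not_less intro: order_trans)
  define m where "m = Max (D ` T)"
  have "x \<in> T" by (simp add: T_def)
  then have m: "D x \<le> m" unfolding m_def using T by (intro Max_ge) auto
  have max: "D y \<le> m" for y
  proof (cases "y \<in> T")
    case True
    then show ?thesis unfolding m_def using T by (intro Max_ge) auto
  qed (use m in \<open>auto simp: T_def\<close>)
  have step: "D (y + 1) = m" if "D y = m" for y
  proof -
    have "(\<integral>d. m - D (y + d) \<partial>stable_pmf \<alpha>) = m - (\<integral>d. D (y + d) \<partial>stable_pmf \<alpha>)"
      using int by simp
    also have "\<dots> = 0" using D[of y] that m \<open>\<not> D x \<le> 0\<close> by auto
    \<comment> \<open>A nonnegative function of mean zero vanishes on the support of the step law,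
      which contains 1.\<close>
    finally have "AE d in stable_pmf \<alpha>. m - D (y + d) = 0"
      using int max by (subst (asm) integral_nonneg_eq_0_iff_AE) auto
    then show ?thesis
      using pmf_stable_pmf_1_pos[OF \<alpha>] by (auto simp: AE_measure_pmf_iff set_pmf_iff)
  qed
  have "m \<in> D ` T" unfolding m_def using T \<open>x \<in> T\<close> by (intro Max_in) auto
  then obtain y where y: "D y = m" by auto
  have "D (y + int n) = m" for n
  proof (induction n)
    case (Suc n)
    then show ?case using step[of "y + int n"] by (simp add: ac_simps)
  qed (use y in simp)
  then have "range (\<lambda>n. y + int n) \<subseteq> T" using m by (auto simp: T_def)
  then have "finite (range (\<lambda>n. y + int n))" using T finite_subset by blast
  then show False by (auto dest!: finite_imageD simp: inj_def)
qed

text \<open>The set \<open>A\<close> depends on \<open>x\<close>, but the upper bound of the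
  potential and its lower bound at \<open>x\<close> are both proportional to \<open>S\<close>, so
  \<open>A\<close> drops out of their ratio.\<close>

lemma escape_function_uniform:
  obtains q where "0 < q" "q < 1" 
    "\<And>f x. escape_function \<alpha> {p. prime p} f \<Longrightarrow> f x \<le> q"
proof -
  obtain c where c: "0 < c" "\<And>x. c * (\<bar>of_int x\<bar> + 1) powr (\<alpha> - 1) \<le> green (\<alpha> / 2) x"
    using green_ge by blast
  define C where "C = green (\<alpha> / 2) 0"
  have C: "1 \<le> C" unfolding C_def using \<alpha> by (intro green_0_ge) auto
  \<comment> \<open>The additive \<open>4 / \<alpha>\<close> of \<open>weighted_potential_le\<close>
    is absorbed using \<open>S \<ge> 1\<close>.\<close>
  define Z where "Z = C * (2 + 4 / \<alpha>)"
  have Z: "0 < Z" unfolding Z_def using C \<alpha> by (intro mult_pos_pos add_pos_pos) auto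
  \<comment> \<open>Lower bound \<open>c / 2 * S\<close> at \<open>x\<close> over upper bound
    \<open>Z * S\<close>.\<close>
  define k where "k = (c / 2) / Z"
  have k: "0 < k" using c Z by (simp add: k_def)
  have main: "f x \<le> 1 - k" if f: "escape_function \<alpha> {p. prime p} f" for f and x :: int
  proof -
    have f01: "0 \<le> f y" "f y \<le> 1" for y using f by (auto simp: escape_function_def)
    obtain A :: "nat set" where A: "finite A" "A \<subseteq> {p. prime p}" "A \<inter> {..nat \<bar>x\<bar>} = {}"
      and S1: "(\<Sum>p\<in>A. 1 / real p) \<ge> 1"
      using inverse_primes_unbounded[of "{..nat \<bar>x\<bar>}" 1] by blast
    define S where "S = (\<Sum>p\<in>A. 1 / real p)"
    define F where "F y = (\<Sum>p\<in>A. real p powr (- \<alpha>) * green (\<alpha> / 2) (y - int p))" for y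
    define M where "M = Z * S"
    have S: "1 \<le> S" using S1 by (simp add: S_def)
    have M: "0 < M" using Z S by (simp add: M_def)
    have F_le: "F y \<le> M" for y
    proof -
      have "F y \<le> (\<Sum>p\<in>A. real p powr (- \<alpha>) * (C * (\<bar>of_int y - real p\<bar> + 1) powr (\<alpha> - 1)))"
        unfolding F_def C_def using green_le[of "y - int p" for p] by (intro sum_mono mult_left_mono) auto
      also have "\<dots> = C * (\<Sum>p\<in>A. real p powr (- \<alpha>) * (\<bar>of_int y - real p\<bar> + 1) powr (\<alpha> - 1))"
        by (simp add: sum_distrib_left mult_ac)
      also have "\<dots> \<le> C * (2 * S + 4 / \<alpha>)"
        unfolding S_def using A C \<alpha> by (intro mult_left_mono weighted_potential_le) (auto simp: prime_gt_0_nat)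
      also have "\<dots> \<le> C * ((2 + 4 / \<alpha>) * S)"
      proof (rule mult_left_mono)
        show "2 * S + 4 / \<alpha> \<le> (2 + 4 / \<alpha>) * S"
          using mult_left_mono[OF S, of "4 / \<alpha>"] \<alpha> by (simp add: distrib_right)
      qed (use C in simp)
      finally show ?thesis by (simp add: M_def Z_def mult.assoc)
    qed
    have F_int: "integrable (stable_pmf \<alpha>) (\<lambda>d. F (y + d))" for y
      unfolding F_def using integral_green(1)[OF \<alpha>, of "y - int p" for p]
      by (intro Bochner_Integration.integrable_sum integrable_mult_right) (simp add: algebra_simps)
    have F_harm: "(\<integral>d. F (y + d) \<partial>stable_pmf \<alpha>) = F y" if "\<not> prime y" for y
    proof -
      have shift: "green (\<alpha> / 2) (y + d - int p) = green (\<alpha> / 2) ((y - int p) + d)" for d p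
        by (simp add: algebra_simps)
      have "(\<integral>d. F (y + d) \<partial>stable_pmf \<alpha>) 
          = (\<Sum>p\<in>A. real p powr (- \<alpha>) * (\<integral>d. green (\<alpha> / 2) ((y - int p) + d) \<partial>stable_pmf \<alpha>))"
        unfolding F_def shift using integral_green(1)[OF \<alpha>]
        by (subst Bochner_Integration.integral_sum) auto
      also have "\<dots> = F y"
        unfolding F_def integral_green(2)[OF \<alpha>] using A that by (intro sum.cong) auto
      finally show ?thesis .
    qed
    have f_int: "integrable (stable_pmf \<alpha>) (\<lambda>d. f (y + d))" for y
      using f01 by (intro measure_pmf.integrable_const_bound[where B = 1]) auto
    \<comment> \<open>On primes \<open>f\<close> vanishes and \<open>F \<le> M\<close>, so
      \<open>D \<le> 0\<close>. Elsewhere \<open>F\<close>, \<open>f\<close> and constants equal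
      their means, hence so does \<open>D\<close>.\<close>
    define D where "D y = F y - M * (1 - f y)" for y
    have "D x \<le> 0"
    proof (rule maximum_principle)
      show "D y \<le> F y" for y using f01[of y] M by (simp add: D_def)
      show "(F \<longlongrightarrow> 0) cofinite"
        unfolding F_def by (intro tendsto_null_sum tendsto_mult_right_zero green_tendsto_0)
      show "integrable (stable_pmf \<alpha>) (\<lambda>d. D (y + d))" for y
        unfolding D_def by (intro Bochner_Integration.integrable_diff F_int integrable_mult_right f_int integrable_const) auto
      show "D y \<le> 0 \<or> D y = (\<integral>d. D (y + d) \<partial>stable_pmf \<alpha>)" for y
      proof (cases "prime y")
        case True
        then show ?thesis using f F_le[of y] by (simp add: D_def escape_function_def)
      next
        case False
        then have "f y = (\<integral>d. f (y + d) \<partial>stable_pmf \<alpha>)" using f by (simp add: escape_function_def)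
        then show ?thesis
          unfolding D_def using F_int[of y] f_int[of y] F_harm[OF False] by simp
      qed
    qed
    then have "F x \<le> M * (1 - f x)" by (simp add: D_def)
    moreover have "c / 2 * S \<le> F x"
    proof -
      have "\<bar>x\<bar> + 1 \<le> int p" if "p \<in> A" for p
      proof -
        have "\<not> p \<le> nat \<bar>x\<bar>" using A(3) that by auto
        then show ?thesis by (simp add: not_le nat_less_iff)
      qed
      then have "c * (S / 2) \<le> c * (\<Sum>p\<in>A. real p powr (- \<alpha>) * (\<bar>of_int x - real p\<bar> + 1) powr (\<alpha> - 1))"
        unfolding S_def using A c \<alpha> by (intro mult_left_mono weighted_potential_ge) auto
      also have "\<dots> = (\<Sum>p\<in>A. real p powr (- \<alpha>) * (c * (\<bar>of_int x - real p\<bar> + 1) powr (\<alpha> - 1)))"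
        by (simp add: sum_distrib_left mult_ac)
      also have "\<dots> \<le> F x"
        unfolding F_def using c(2)[of "x - int p" for p] by (intro sum_mono mult_left_mono) auto
      finally show ?thesis by simp
    qed
    moreover have "k * M = c / 2 * S" using Z by (simp add: k_def M_def)
    ultimately have "k * M \<le> M * (1 - f x)" by simp
    then show ?thesis using M by (simp add: mult.commute)
  qed
  show ?thesis
  \<comment> \<open>The maximum with 1/2 keeps \<open>q\<close> positive, so that dividing by its
    powers is possible.\<close>
  proof (rule that[of "max (1 - k) (1 / 2)"])
    show "f x \<le> max (1 - k) (1 / 2)" if "escape_function \<alpha> {p. prime p} f" for f x
      using main[OF that, of x] by simp
  qed (use k in auto)
qed

lemma escape_function_zero:
  assumes f: "escape_function \<alpha> {p. prime p} f"
  shows "f x = 0"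
proof -
  obtain q where q: "0 < q" "q < 1" "\<And>f x. escape_function \<alpha> {p. prime p} f \<Longrightarrow> f x \<le> q"
    using escape_function_uniform by blast
  have "\<forall>x. f x \<le> q ^ n" for n
  proof (induction n)
    case 0
    then show ?case using f by (auto simp: escape_function_def)
  next
    case (Suc n)
    \<comment> \<open>The defining conditions are homogeneous except for the upper bound 1, which
      the induction hypothesis supplies.\<close>
    then have "escape_function \<alpha> {p. prime p} (\<lambda>x. f x / q ^ n)"
      using f q by (auto simp: escape_function_def)
    then have "f x / q ^ n \<le> q" for x by (rule q(3))
    then show ?case using q(1) by (simp add: field_simps)
  qed
  moreover have "(\<lambda>n. q ^ n) \<longlonglongrightarrow> 0" using q by (intro LIMSEQ_realpow_zero) auto
  ultimately have "f x \<le> 0" by (intro LIMSEQ_le_const[of "\<lambda>n. q ^ n"]) auto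
  then show ?thesis using f by (auto simp: escape_function_def intro: antisym)
qed

end

theorem theorem2p5:
  fixes \<alpha> :: real
  assumes "0 < \<alpha>" and "\<alpha> < 1"
  shows "stable_massive \<alpha> {p :: int. prime p}"
  using assms by (intro stable_massiveI escape_function_zero)

end
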